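(* Let $V\subset\mathbb{Z}^n$ be finite with $0\in V$, and let $\mathcal{L}\subset\mathbb{Z}^n$ be such that $\{V+l : l\in\mathcal{L}\}$ is a tiling of $\mathbb{Z}^n$ by translates of $V$. Let $T:\mathbb{Z}[x_1^{\pm1},\dots,x_n^{\pm1}]\to\mathbb{Z}$ be the $\mathbb{Z}$-linear map with $T(x_1^{a_1}\cdots x_n^{a_n})=1$ if $(a_1,\dots,a_n)\in\mathcal{L}$ and $0$ otherwise, and let $Q_V=\sum_{(a_1,\dots,a_n)\in -V}x_1^{a_1}\cdots x_n^{a_n}$. Let $a$ be an integer relatively prime to $|V|$. Then for every Laurent polynomial $P\in\mathbb{Z}[x_1^{\pm1},\dots,x_n^{\pm1}]$, \[T\big(P\cdot Q_V(x_1^a,\dots,x_n^a)\big)=P(1,\dots,1).\]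
   Context: A tiling of $\mathbb{Z}^n$ by translates of $V$ is a family $\{V+l: l\in\mathcal{L}\}$ such that every $x\in\mathbb{Z}^n$ can be written uniquely as $x=v+l$ with $v\in V$, $l\in\mathcal{L}$. *)

theory Defs
  imports "HOL-Analysis.Finite_Cartesian_Product" "HOL-Library.Poly_Mapping"
begin

definition is_tiling :: "(int ^ 'n) set \<Rightarrow> (int ^ 'n) set \<Rightarrow> bool" where
  "is_tiling V L \<longleftrightarrow> (\<forall>x. \<exists>!p. p \<in> V \<times> L \<and> x = fst p + snd p)"

text \<open>
  The ring of Laurent polynomials over the integers in the variables indexed by 'n is the group
  ring of the exponent group: a finitely supported function from exponent vectors to coefficients,
  with the convolution product.
\<close>

type_synonym 'n laurent = "(int ^ 'n) \<Rightarrow>\<^sub>0 int"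

abbreviation laurent_monom :: "int ^ 'n \<Rightarrow> 'n::finite laurent" where
  "laurent_monom k \<equiv> Poly_Mapping.single k 1"

definition laurent_var :: "'n \<Rightarrow> 'n::finite laurent" where
  "laurent_var i = laurent_monom (axis i 1)"

text \<open>Integer powers of a unit of a commutative ring; junk for negative exponents of non-units.\<close>

definition unit_pow :: "'r::comm_ring_1 \<Rightarrow> int \<Rightarrow> 'r" where
  "unit_pow u k = (if k \<ge> 0 then u ^ nat k else (THE v. u * v = 1) ^ nat (- k))"

text \<open>
  The value P(u) of a Laurent polynomial at a tuple u of units of an arbitrary commutative ring.
  Taking that ring to be the Laurent polynomial ring itself gives substitution.
\<close>

definition laurent_eval :: "('n \<Rightarrow> 'r::comm_ring_1) \<Rightarrow> 'n::finite laurent \<Rightarrow> 'r" where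
  "laurent_eval u P =
     (\<Sum>k\<in>Poly_Mapping.keys P.
        of_int (Poly_Mapping.lookup P k) * (\<Prod>i\<in>UNIV. unit_pow (u i) (k $ i)))"

definition Q_poly :: "(int ^ 'n) set \<Rightarrow> 'n::finite laurent" where
  "Q_poly V = (\<Sum>k\<in>uminus ` V. laurent_monom k)"

lemma unit_pow_monom:
  "unit_pow (laurent_monom (k :: int ^ 'n::finite)) a = laurent_monom (a *s k)"
proof -
  have pow: "laurent_monom (k :: int ^ 'n) ^ m = laurent_monom (int m *s k)" for k m
    by (induction m) (simp_all add: Poly_Mapping.mult_single vector_sadd_rdistrib flip: single_one)
  have "(THE v. laurent_monom k * v = 1) = laurent_monom (- k)"
  proof (rule the_equality)
    show inv: "laurent_monom k * laurent_monom (- k) = 1"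
      by (simp add: Poly_Mapping.mult_single)
    show "v = laurent_monom (- k)" if "laurent_monom k * v = 1" for v
    proof -
      have "v = (laurent_monom k * laurent_monom (- k)) * v"
        by (simp only: inv mult_1_left)
      also have "\<dots> = laurent_monom (- k) * (laurent_monom k * v)"
        by (simp only: mult_ac)
      finally show ?thesis
        by (simp only: that mult_1_right)
    qed
  qed
  moreover have "int (nat (- a)) *s (- k) = a *s k" if "a < 0"
    using that by (simp add: vec_eq_iff)
  ultimately show ?thesis
    by (simp add: unit_pow_def pow)
qed

lemma unit_pow_one: "unit_pow (1 :: 'r::comm_ring_1) k = 1"
  by (simp add: unit_pow_def)

lemma prod_monom:
  "finite A \<Longrightarrow> (\<Prod>i\<in>A. laurent_monom (f i :: int ^ 'n::finite)) = laurent_monom (\<Sum>i\<in>A. f i)"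
  by (induction A rule: finite_induct) (simp_all add: Poly_Mapping.mult_single)

lemma laurent_eval_one: "laurent_eval (\<lambda>_. 1) P = (\<Sum>k\<in>Poly_Mapping.keys P. Poly_Mapping.lookup P k)"
  for P :: "'n::finite laurent"
  by (simp add: laurent_eval_def unit_pow_one)

lemma laurent_eval_var_pow_monom:
  "laurent_eval (\<lambda>i. unit_pow (laurent_var i) a) (laurent_monom (k :: int ^ 'n::finite))
     = laurent_monom (a *s k)"
proof -
  have "(\<Prod>i\<in>UNIV. unit_pow (unit_pow (laurent_var i) a) (k $ i))
      = laurent_monom (\<Sum>i\<in>UNIV. k $ i *s (a *s axis i 1))"
    by (simp add: laurent_var_def unit_pow_monom prod_monom)
  also have "(\<Sum>i\<in>UNIV. k $ i *s (a *s axis i 1)) = a *s k"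
    by (simp add: vec_eq_iff axis_def if_distrib cong: if_cong)
  finally show ?thesis
    by (simp add: laurent_eval_def)
qed

text \<open>The linear functional with value 1 on the monomials with exponent in L and 0 on the others.\<close>

lemma ex1_indicator_functional:
  fixes L :: "(int ^ 'n::finite) set"
  shows "\<exists>!T :: 'n laurent \<Rightarrow> int.
           (\<forall>R S. T (R + S) = T R + T S) \<and> (\<forall>c R. T (of_int c * R) = c * T R) \<and>
           (\<forall>k. T (laurent_monom k) = (if k \<in> L then 1 else 0))"
proof -
  define T :: "'n laurent \<Rightarrow> int"
    where "T = (\<lambda>R. \<Sum>k\<in>Poly_Mapping.keys R. if k \<in> L then Poly_Mapping.lookup R k else 0)"
  have T_on: "T R = (\<Sum>k\<in>A. if k \<in> L then Poly_Mapping.lookup R k else 0)"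
    if "finite A" "Poly_Mapping.keys R \<subseteq> A" for R A
    unfolding T_def by (rule sum.mono_neutral_left) (use that in \<open>auto simp: in_keys_iff\<close>)
  have add: "T (R + S) = T R + T S" for R S
  proof -
    let ?A = "Poly_Mapping.keys R \<union> Poly_Mapping.keys S"
    have "T (R + S) = (\<Sum>k\<in>?A. if k \<in> L then Poly_Mapping.lookup (R + S) k else 0)"
      by (rule T_on) (auto dest: subsetD[OF Poly_Mapping.keys_add])
    also have "\<dots> = (\<Sum>k\<in>?A. if k \<in> L then Poly_Mapping.lookup R k else 0) +
                    (\<Sum>k\<in>?A. if k \<in> L then Poly_Mapping.lookup S k else 0)"
      unfolding sum.distrib[symmetric] by (rule sum.cong) (auto simp: lookup_add)
    also have "\<dots> = T R + T S"
      by (simp add: T_on[of ?A R] T_on[of ?A S])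
    finally show ?thesis .
  qed
  have scale: "T (of_int c * R) = c * T R" for c R
  proof -
    have zero: "T 0 = 0" using add[of 0 0] by simp
    have neg: "T (- R) = - T R" for R using add[of R "- R"] zero by simp
    have nat: "T (of_nat m * R) = int m * T R" for m R
      by (induction m) (simp_all add: zero add algebra_simps)
    show ?thesis
      by (cases c rule: int_cases2) (simp_all add: nat neg)
  qed
  have monom: "T (laurent_monom k) = (if k \<in> L then 1 else 0)" for k
    by (simp add: T_def)
  have uniq: "U = T"
    if U: "\<And>R S. U (R + S) = U R + U S"
      and U1: "\<And>k. U (laurent_monom k) = (if k \<in> L then 1 else 0)" for U :: "'n laurent \<Rightarrow> int"
  proof
    fix R :: "'n laurent"
    have U0: "U 0 = 0" and T0: "T 0 = 0"
      using U[of 0 0] add[of 0 0] by simp_all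
    have diff: "U (R - S) = U R - U S" "T (R - S) = T R - T S" for R S
      using U[of "R - S" S] add[of "R - S" S] by simp_all
    have "Poly_Mapping.keys R \<subseteq> UNIV" by simp
    then show "U R = T R"
      by (induction R rule: frag_induction) (simp_all only: U0 T0 U1 monom diff)
  qed
  show ?thesis
  proof (rule ex1I[of _ T])
    show "(\<forall>R S. T (R + S) = T R + T S) \<and> (\<forall>c R. T (of_int c * R) = c * T R) \<and>
        (\<forall>k. T (laurent_monom k) = (if k \<in> L then 1 else 0))"
      using add scale monom by simp
  qed (rule uniq, simp_all)
qed

end

theory Submission
  imports Defs "HOL-Computational_Algebra.Primes"
begin

text \<open>
  Write \<open>c W k\<close> for \<open>T (x\<^sup>k Q\<^sub>W)\<close>, the number of \<open>w \<in> W\<close> with \<open>k - w \<in> L\<close>; the sets \<open>W + l\<close> tile iff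
  \<open>c W = 1\<close> everywhere. If \<open>W\<close> tiles and \<open>W'\<close> has the same size, evaluating \<open>T (x\<^sup>k Q\<^sub>W Q\<^sub>W\<^sub>')\<close> in two ways
  shows that the \<open>card W\<close> numbers \<open>c W' (k - w)\<close>, \<open>w \<in> W\<close>, have average 1. Hence it suffices to bound
  \<open>c W'\<close> by 1 on one side.
  For \<open>W' = p W\<close> with a prime \<open>p\<close> not dividing \<open>card W\<close>, the congruence \<open>Q(x\<^sup>p) \<equiv> Q(x)\<^sup>p\<close> modulo \<open>p\<close>
  gives \<open>c W' \<equiv> (card W)\<^sup>p\<^sup>-\<^sup>1 \<noteq> 0\<close> modulo \<open>p\<close>, so \<open>c W' \<ge> 1\<close>. For \<open>W' = - W\<close>, two translates of \<open>W\<close>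
  being disjoint gives \<open>c W' \<le> 1\<close>. Every multiplier coprime to \<open>card W\<close> is composed of these.
\<close>

section \<open>The Frobenius congruence modulo a prime in a commutative ring\<close>

lemma prime_dvd_add_power_diff:
  fixes x y :: "'a::comm_ring_1"
  assumes p: "prime (p::nat)"
  shows "of_nat p dvd (x + y) ^ p - (x ^ p + y ^ p)"
proof -
  \<comment> \<open>The end terms of the binomial expansion cancel against
    \<open>x ^ p + y ^ p\<close>; every inner binomial coefficient is divisible by
    \<open>p\<close>.\<close>
  have split: "{..p} = insert 0 (insert p {0<..<p})"
    using prime_gt_0_nat[OF p] by auto
  have "(x + y) ^ p - (x ^ p + y ^ p)
      = (\<Sum>k\<in>{0<..<p}. of_nat (p choose k) * x ^ k * y ^ (p - k))"
    using prime_gt_0_nat[OF p] by (simp add: binomial_ring split)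
  also have "of_nat p dvd \<dots>"
  proof (rule dvd_sum)
    fix k assume "k \<in> {0<..<p}"
    then have "p dvd (p choose k)"
      using p by (intro dvd_choose_prime) auto
    then have "(of_nat p :: 'a) dvd of_nat (p choose k)"
      by (auto elim!: dvdE)
    then show "(of_nat p :: 'a) dvd of_nat (p choose k) * x ^ k * y ^ (p - k)"
      by (simp add: dvd_mult2)
  qed
  finally show ?thesis .
qed

lemma prime_dvd_sum_power_diff:
  fixes f :: "'b \<Rightarrow> 'a::comm_ring_1"
  assumes p: "prime (p::nat)" and "finite A"
  shows "of_nat p dvd (\<Sum>i\<in>A. f i) ^ p - (\<Sum>i\<in>A. f i ^ p)"
  using \<open>finite A\<close>
proof (induction A rule: finite_induct)
  case empty
  then show ?case using prime_gt_0_nat[OF p] by (simp add: zero_power)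
next
  case (insert i A)
  have "of_nat p dvd ((f i + sum f A) ^ p - (f i ^ p + sum f A ^ p))
                   + (sum f A ^ p - (\<Sum>i\<in>A. f i ^ p))"
    by (intro dvd_add prime_dvd_add_power_diff p insert.IH)
  then show ?case
    using insert.hyps by (simp add: algebra_simps)
qed

section \<open>\<open>Q_poly\<close> and its substitutions\<close>

lemma Q_poly_eq_sum: "Q_poly W = (\<Sum>w\<in>W. laurent_monom (- w))"
  unfolding Q_poly_def by (subst sum.reindex) (auto simp: inj_on_def)

lemma lookup_Q_poly:
  assumes "finite W"
  shows "Poly_Mapping.lookup (Q_poly W) k = (if k \<in> uminus ` W then 1 else 0)"
proof -
  have "finite (uminus ` W)" using assms by simp
  then show ?thesis
    by (simp add: Q_poly_def lookup_sum lookup_single when_def sum.delta')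
qed

lemma keys_Q_poly: "finite W \<Longrightarrow> Poly_Mapping.keys (Q_poly W) = uminus ` W"
  by (auto simp: in_keys_iff lookup_Q_poly split: if_splits)

lemma inj_vector_smult: "a \<noteq> 0 \<Longrightarrow> inj (\<lambda>v. a *s v)" for a :: int
  by (auto simp: inj_def vec_eq_iff)

lemma laurent_eval_var_pow_Q_poly:
  assumes "finite W"
  shows "laurent_eval (\<lambda>i. unit_pow (laurent_var i) a) (Q_poly W)
       = (\<Sum>w\<in>W. laurent_monom (a *s (- w)))"
proof -
  have "laurent_eval (\<lambda>i. unit_pow (laurent_var i) a) (Q_poly W)
      = (\<Sum>k\<in>uminus ` W. laurent_eval (\<lambda>i. unit_pow (laurent_var i) a) (laurent_monom k))"
    unfolding laurent_eval_def[of _ "Q_poly W"] keys_Q_poly[OF assms]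
    by (rule sum.cong) (auto simp: lookup_Q_poly assms laurent_eval_def)
  also have "\<dots> = (\<Sum>w\<in>W. laurent_monom (a *s (- w)))"
    by (subst sum.reindex) (auto simp: inj_on_def laurent_eval_var_pow_monom)
  finally show ?thesis .
qed

text \<open>For nonzero \<open>a\<close> dilation is injective, so no two monomials merge. This
  turns the substitution into a question about the dilated set.\<close>

lemma laurent_eval_var_pow_Q_poly_smult:
  assumes "finite W" "a \<noteq> 0"
  shows "laurent_eval (\<lambda>i. unit_pow (laurent_var i) a) (Q_poly W) = Q_poly ((\<lambda>v. a *s v) ` W)"
  unfolding laurent_eval_var_pow_Q_poly[OF assms(1)] Q_poly_eq_sum[of "_ ` _"]
  by (subst sum.reindex)
    (auto intro: inj_on_subset[OF inj_vector_smult[OF assms(2)]] simp: vector_smult_rneg)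

lemma laurent_eq_sum_monoms:
  "R = (\<Sum>k\<in>Poly_Mapping.keys R. of_int (Poly_Mapping.lookup R k) * laurent_monom k)"
  for R :: "'n::finite laurent"
proof (rule poly_mapping_eqI)
  fix j
  have "of_int c * laurent_monom k = Poly_Mapping.single k c" for c :: int and k :: "int ^ 'n"
    by (metis Poly_Mapping.mult_single add_0 mult.right_neutral single_of_int of_int_eq_id id_apply)
  then show "Poly_Mapping.lookup R j = Poly_Mapping.lookup
      (\<Sum>k\<in>Poly_Mapping.keys R. of_int (Poly_Mapping.lookup R k) * laurent_monom k) j"
    by (simp add: lookup_sum lookup_single when_def in_keys_iff)
qed

section \<open>Tilings seen through the functional \<open>T\<close>\<close>

locale indicator_functional =
  fixes L :: "(int ^ 'n::finite) set" and T :: "'n laurent \<Rightarrow> int"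
  assumes T_add: "T (R + S) = T R + T S"
    and T_scale: "T (of_int c * R) = c * T R"
    and T_monom: "T (laurent_monom k) = (if k \<in> L then 1 else 0)"
begin

lemma T_zero: "T 0 = 0"
  using T_add[of 0 0] by simp

lemma T_sum: "T (\<Sum>i\<in>A. f i) = (\<Sum>i\<in>A. T (f i))"
  by (induction A rule: infinite_finite_induct) (simp_all add: T_zero T_add)

lemma T_diff: "T (R - S) = T R - T S"
  using T_add[of "R - S" S] by simp

text \<open>Phrased through \<open>T\<close> so that identities in the Laurent polynomial ring apply
  directly; \<open>tiles_iff\<close> recovers the combinatorial meaning.\<close>

definition tiles :: "(int ^ 'n) set \<Rightarrow> bool" where
  "tiles W \<longleftrightarrow> finite W \<and> (\<forall>k. T (laurent_monom k * Q_poly W) = 1)"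

lemma T_monom_Q_poly_mult:
  "T (laurent_monom k * Q_poly W * R) = (\<Sum>w\<in>W. T (laurent_monom (k - w) * R))"
  by (simp add: Q_poly_eq_sum sum_distrib_left sum_distrib_right T_sum Poly_Mapping.mult_single)

lemma T_monom_Q_poly:
  assumes "finite W"
  shows "T (laurent_monom k * Q_poly W) = int (card {w \<in> W. k - w \<in> L})"
  using T_monom_Q_poly_mult[of k W 1] assms
  by (simp add: T_monom sum.If_cases Int_def)

lemma tiles_iff: "tiles W \<longleftrightarrow> finite W \<and> (\<forall>k. \<exists>!w. w \<in> W \<and> k - w \<in> L)"
proof -
  have "card {w \<in> W. k - w \<in> L} = 1 \<longleftrightarrow> (\<exists>!w. w \<in> W \<and> k - w \<in> L)" for k
    unfolding card_1_singleton_iff[folded One_nat_def] set_eq_iff mem_Collect_eq singleton_iff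
    by metis
  then have "T (laurent_monom k * Q_poly W) = 1 \<longleftrightarrow> (\<exists>!w. w \<in> W \<and> k - w \<in> L)"
    if "finite W" for k
    by (simp only: T_monom_Q_poly[OF that] of_nat_eq_1_iff)
  then show ?thesis
    by (simp only: tiles_def cong: conj_cong)
qed

lemma tiles_card_pos: "tiles W \<Longrightarrow> card W > 0"
  by (auto simp: tiles_iff card_gt_0_iff)

text \<open>By linearity only monomials matter. The theorem is thereby reduced to showing that the
  dilate of \<open>V\<close> tiles with the same \<open>L\<close>.\<close>

lemma T_mult_Q_poly_of_tiles:
  assumes "tiles W"
  shows "T (P * Q_poly W) = laurent_eval (\<lambda>_. 1) P"
proof -
  have "T (P * Q_poly W) = T (\<Sum>k\<in>Poly_Mapping.keys P.
      of_int (Poly_Mapping.lookup P k) * (laurent_monom k * Q_poly W))"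
    by (subst laurent_eq_sum_monoms[of P]) (simp only: sum_distrib_right mult.assoc)
  also have "\<dots> = laurent_eval (\<lambda>_. 1) P"
    using assms by (simp add: T_sum T_scale laurent_eval_one tiles_def)
  finally show ?thesis .
qed

text \<open>Expanding one factor \<open>Q_poly W\<close> gives \<open>card W\<close> shifted terms,
  all of the same value by induction.\<close>

lemma T_monom_Q_poly_power:
  assumes "tiles W"
  shows "T (laurent_monom k * Q_poly W ^ Suc m) = int (card W) ^ m"
proof (induction m arbitrary: k)
  case 0
  then show ?case using assms by (simp add: tiles_def)
next
  case (Suc m)
  have "T (laurent_monom k * Q_poly W ^ Suc (Suc m))
      = T (laurent_monom k * Q_poly W * Q_poly W ^ Suc m)"
    by (simp only: power_Suc[of _ "Suc m"] mult.assoc)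
  also have "\<dots> = int (card W) ^ Suc m"
    by (simp only: T_monom_Q_poly_mult Suc.IH) simp
  finally show ?case .
qed

text \<open>Both sides evaluate \<open>T\<close> at one product: expanding \<open>Q_poly W\<close>
  gives the sum, while expanding \<open>Q_poly W'\<close> gives \<open>card W'\<close> terms equal
  to 1.\<close>

lemma sum_T_monom_Q_poly_translates:
  assumes "tiles W"
  shows "(\<Sum>w\<in>W. T (laurent_monom (k - w) * Q_poly W')) = int (card W')"
proof -
  have "(\<Sum>w\<in>W. T (laurent_monom (k - w) * Q_poly W'))
      = T (laurent_monom k * Q_poly W' * Q_poly W)"
    using T_monom_Q_poly_mult[of k W "Q_poly W'"]
    by (simp only: mult.assoc mult.commute[of "Q_poly W"])
  also have "\<dots> = int (card W')"
    using assms by (simp only: T_monom_Q_poly_mult) (simp add: tiles_def)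
  finally show ?thesis .
qed

lemma tiles_if_one_sided_bound:
  assumes W: "tiles W" and W': "finite W'" "card W' = card W"
    and bound: "(\<forall>k. T (laurent_monom k * Q_poly W') \<ge> 1) \<or>
                (\<forall>k. T (laurent_monom k * Q_poly W') \<le> 1)"
  shows "tiles W'"
  unfolding tiles_def
proof (intro conjI allI)
  fix k
  define f where "f k = T (laurent_monom k * Q_poly W')" for k
  from W have fin: "finite W" by (simp add: tiles_def)
  obtain w0 where w0: "w0 \<in> W"
    using tiles_card_pos[OF W] fin by (auto simp: card_gt_0_iff)
  \<comment> \<open>The shift by \<open>w0\<close> makes \<open>f k\<close> itself one of the
    summands, namely the one at \<open>w = w0\<close>.\<close>
  have "(\<Sum>w\<in>W. f (k + w0 - w)) = int (card W)"
    unfolding f_def by (simp only: sum_T_monom_Q_poly_translates[OF W] W')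
  then have sums: "(\<Sum>w\<in>W. f (k + w0 - w) - 1) = 0" "(\<Sum>w\<in>W. 1 - f (k + w0 - w)) = 0"
    by (simp_all add: sum_subtractf)
  have "f (k + w0 - w0) = 1"
    using bound
  proof
    assume "\<forall>k. T (laurent_monom k * Q_poly W') \<ge> 1"
    then have nonneg: "f (k + w0 - w) - 1 \<ge> 0" for w
      unfolding f_def diff_ge_0_iff_ge by blast
    show ?thesis
      using sum_nonneg_0[OF fin nonneg sums(1) w0] by linarith
  next
    assume "\<forall>k. T (laurent_monom k * Q_poly W') \<le> 1"
    then have nonneg: "1 - f (k + w0 - w) \<ge> 0" for w
      unfolding f_def diff_ge_0_iff_ge by blast
    show ?thesis
      using sum_nonneg_0[OF fin nonneg sums(2) w0] by linarith
  qed
  then show "T (laurent_monom k * Q_poly W') = 1"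
    by (simp add: f_def)
qed (fact W')

section \<open>Multipliers that preserve tilings\<close>

lemma tiles_uminus:
  assumes "tiles W"
  shows "tiles (uminus ` W)"
proof (rule tiles_if_one_sided_bound[OF assms])
  from assms have fin: "finite W" by (simp add: tiles_def)
  then show "finite (uminus ` W)" by simp
  show "card (uminus ` W) = card W" by (simp add: card_image)
  have "card {w \<in> uminus ` W. k - w \<in> L} \<le> 1" for k
  proof (subst One_nat_def, subst card_le_Suc0_iff_eq)
    show "\<forall>v\<in>{w \<in> uminus ` W. k - w \<in> L}. \<forall>w\<in>{w \<in> uminus ` W. k - w \<in> L}. v = w"
    proof clarsimp
      fix v w assume vw: "v \<in> W" "k + v \<in> L" "w \<in> W" "k + w \<in> L"
      \<comment> \<open>The point \<open>k + v + w\<close> is both \<open>w + (k + v)\<close> and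
        \<open>v + (k + w)\<close>, so uniqueness of its decomposition forces
        \<open>v = w\<close>.\<close>
      have "(k + v + w) - w \<in> L" "(k + v + w) - v \<in> L"
        using vw by (simp_all add: algebra_simps)
      then show "v = w"
        using assms vw unfolding tiles_iff by blast
    qed
  qed (use fin in simp)
  then show "(\<forall>k. T (laurent_monom k * Q_poly (uminus ` W)) \<ge> 1) \<or>
        (\<forall>k. T (laurent_monom k * Q_poly (uminus ` W)) \<le> 1)"
    using fin by (simp add: T_monom_Q_poly)
qed

lemma tiles_smult_prime:
  assumes W: "tiles W" and p: "prime (p::nat)" and ndvd: "\<not> p dvd card W"
  shows "tiles ((\<lambda>v. int p *s v) ` W)" (is "tiles ?pW")
proof (rule tiles_if_one_sided_bound[OF W])
  from W have fin: "finite W" by (simp add: tiles_def)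
  then show "finite ?pW" by simp
  have inj: "inj_on (\<lambda>v. int p *s v) W"
    using p by (intro inj_on_subset[OF inj_vector_smult]) auto
  then show "card ?pW = card W" by (rule card_image)
  have pow: "laurent_monom (k :: int ^ 'n) ^ p = laurent_monom (int p *s k)" for k
    using unit_pow_monom[of k "int p"] by (simp add: unit_pow_def)
  have Q: "Q_poly ?pW = (\<Sum>w\<in>W. laurent_monom (- w) ^ p)"
    unfolding Q_poly_eq_sum pow by (simp add: sum.reindex[OF inj] vector_smult_rneg)
  have "of_nat p dvd Q_poly W ^ p - Q_poly ?pW"
    unfolding Q unfolding Q_poly_eq_sum by (rule prime_dvd_sum_power_diff[OF p fin])
  then obtain R where R: "Q_poly W ^ p - Q_poly ?pW = of_int (int p) * R"
    by (auto elim: dvdE)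
  have "T (laurent_monom k * Q_poly ?pW) \<ge> 1" for k
  proof -
    have "laurent_monom k * Q_poly W ^ p - laurent_monom k * Q_poly ?pW
        = of_int (int p) * (laurent_monom k * R)"
      using R by (simp only: right_diff_distrib[symmetric] mult_ac)
    then have "T (laurent_monom k * Q_poly W ^ p) - T (laurent_monom k * Q_poly ?pW)
        = int p * T (laurent_monom k * R)"
      by (metis T_diff T_scale)
    moreover have "T (laurent_monom k * Q_poly W ^ p) = int (card W) ^ (p - 1)"
      using T_monom_Q_poly_power[OF W, of k "p - 1"] prime_gt_0_nat[OF p] by simp
    ultimately have "int (card W ^ (p - 1))
        = T (laurent_monom k * Q_poly ?pW) + int p * T (laurent_monom k * R)"
      by simp
    moreover have "\<not> int p dvd int (card W ^ (p - 1))"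
      unfolding int_dvd_int_iff using ndvd p prime_dvd_power by blast
    \<comment> \<open>Were this value 0, \<open>p\<close> would divide a power of
      \<open>card W\<close>. Being a cardinality, it is then at least 1.\<close>
    ultimately have "T (laurent_monom k * Q_poly ?pW) \<noteq> 0"
      by auto
    then show ?thesis
      using T_monom_Q_poly[OF \<open>finite ?pW\<close>, of k] by simp
  qed
  then show "(\<forall>k. T (laurent_monom k * Q_poly ?pW) \<ge> 1) \<or>
      (\<forall>k. T (laurent_monom k * Q_poly ?pW) \<le> 1)" by blast
qed

text \<open>Prime factors are applied one at a time; dilation keeps the cardinality, so coprimality
  survives for the remaining factor.\<close>

lemma tiles_smult_nat:
  assumes "tiles W" "n > 0" "coprime n (card W)"
  shows "tiles ((\<lambda>v. int n *s v) ` W)"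
  using assms
proof (induction n arbitrary: W rule: prime_divisors_induct)
  case (unit n)
  then show ?case by simp
next
  case (factor p n)
  have card: "card ((\<lambda>v. int p *s v) ` W) = card W"
    using factor.hyps by (intro card_image inj_on_subset[OF inj_vector_smult]) auto
  have "\<not> p dvd card W"
    using factor by (metis coprime_mult_left_iff coprime_absorb_left not_prime_unit)
  then have "tiles ((\<lambda>v. int p *s v) ` W)"
    using factor by (intro tiles_smult_prime)
  then have "tiles ((\<lambda>v. int n *s v) ` (\<lambda>v. int p *s v) ` W)"
    using factor.prems by (intro factor.IH) (auto simp: card)
  then show ?case
    by (simp add: image_image vector_smult_assoc mult.commute)
qed simp

lemma tiles_smult:
  assumes W: "tiles W" and "a \<noteq> 0" "coprime a (int (card W))"
  shows "tiles ((\<lambda>v. a *s v) ` W)"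
proof -
  have "coprime (nat \<bar>a\<bar>) (card W)"
    using assms(3) by (simp add: coprime_int_iff[symmetric])
  then have abs: "tiles ((\<lambda>v. \<bar>a\<bar> *s v) ` W)"
    using tiles_smult_nat[OF W, of "nat \<bar>a\<bar>"] \<open>a \<noteq> 0\<close> by simp
  show ?thesis
  proof (cases "a > 0")
    case True
    then show ?thesis using abs by simp
  next
    case False
    then have "uminus ` (\<lambda>v. \<bar>a\<bar> *s v) ` W = (\<lambda>v. a *s v) ` W"
      unfolding image_image by (intro image_cong) (auto simp: vec_eq_iff)
    then show ?thesis using tiles_uminus[OF abs] by simp
  qed
qed

end

theorem theorem8:
  fixes V L :: "(int ^ 'n::finite) set"
    and T :: "'n laurent \<Rightarrow> int"
    and a :: int
    and P :: "'n laurent"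
  assumes "finite V" and "0 \<in> V"
    and "is_tiling V L"
    and T_add: "\<And>R S. T (R + S) = T R + T S"
    and T_scale: "\<And>c R. T (of_int c * R) = c * T R"
    and T_monom: "\<And>k. T (laurent_monom k) = (if k \<in> L then 1 else 0)"
    and "coprime a (int (card V))"
  shows "T (P * laurent_eval (\<lambda>i. unit_pow (laurent_var i) a) (Q_poly V))
       = laurent_eval (\<lambda>_. 1) P"
proof -
  interpret indicator_functional L T
    by unfold_locales (fact T_add T_scale T_monom)+
  have tiles: "tiles V"
    unfolding tiles_iff
  proof (intro conjI allI)
    fix k
    obtain p where p: "p \<in> V \<times> L" "k = fst p + snd p"
      and uniq: "\<And>q. q \<in> V \<times> L \<Longrightarrow> k = fst q + snd q \<Longrightarrow> q = p"
      using \<open>is_tiling V L\<close> unfolding is_tiling_def by metis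
    show "\<exists>!w. w \<in> V \<and> k - w \<in> L"
    proof (rule ex1I[of _ "fst p"])
      show "fst p \<in> V \<and> k - fst p \<in> L" using p by auto
      show "w = fst p" if "w \<in> V \<and> k - w \<in> L" for w
        using uniq[of "(w, k - w)"] that by auto
    qed
  qed fact
  show ?thesis
  \<comment> \<open>Dilation by 0 is not injective in general, but here coprimality forces
    \<open>card V = 1\<close>, hence \<open>V = {0}\<close>, and the substitution changes
    nothing.\<close>
  proof (cases "a = 0")
    case True
    then have "card V = 1" using \<open>coprime a (int (card V))\<close> by simp
    then have "V = {0}" using \<open>0 \<in> V\<close> by (auto simp: card_1_singleton_iff)
    then have "laurent_eval (\<lambda>i. unit_pow (laurent_var i) a) (Q_poly V) = Q_poly V"
      using laurent_eval_var_pow_Q_poly[of V a] by (simp add: Q_poly_eq_sum)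
    then show ?thesis using T_mult_Q_poly_of_tiles[OF tiles] by simp
  next
    case False
    then show ?thesis
      using T_mult_Q_poly_of_tiles[OF tiles_smult[OF tiles]] assms
      by (simp add: laurent_eval_var_pow_Q_poly_smult)
  qed
qed

end
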